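(* For every $r\in[0,1]$ there exists a block diagonal operator $T$ on the complex Hilbert space $\ell^2(\mathbb{N}^* )$ which is rigid and whose spectrum is $$\sigma(T)=\{\lambda\in\mathbb{C} : r\le|\lambda|\le 1\}.$$
   Context: $\mathbb{N}^*=\{1,2,3,\dots\}$, and $\ell^2=\ell^2(\mathbb{N}^* )$ is the space of square-summable complex sequences. An operator on a complex normed space $E$ is a continuous linear map $E\to E$. An operator $T$ of $E$ is rigid if there is a strictly increasing sequence of integers $(n_k)_{k\ge1}$ such that for every $x\in E$, $\lim_{k\to+\infty}T^{n_k}x=x$ in norm. Block diagonal operators: let $(n(k))_{k\ge1}$ be a sequence in $\mathbb{N}^*$ and let $E_k=\mathbb{C}^{n(k)}$ with its usual Hermitian structure. By cutting $\mathbb{N}^*$ into consecutive intervals of lengths $n(1),n(2),\dots$, one identifies $\mathbb{C}^{\mathbb{N}^*}$ with $\prod_{k\ge1}E_k$, writing a generic vector as $y=(y_k)_{k\ge1}$ with $y_k\in E_k$; then $y\in\ell^2$ iff $\sum_k\|y_k\|^2<+\infty$, and $\|y\|^2=\sum_k\|y_k\|^2$. Given a linear endomorphism $u_k$ of $E_k$ for each $k\ge 1$, the block diagonal endomorphism $u=(u_k)_{k\ge1}$ of $\mathbb{C}^{\mathbb{N}^*}$ is $u((y_k)_k)=(u_k(y_k))_k$. When $\sup_k\|u_k\|<+\infty$ (operator norms), $u$ maps $\ell^2$ into $\ell^2$ and its restriction $u_{|\ell^2}$ is a continuous linear operator of $\ell^2$, called the block diagonal operator defined by the $u_k$. A block diagonal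 operator on $\ell^2(\mathbb{N}^* )$ is an operator of this form. *)

theory Defs
  imports "HOL-Analysis.Analysis" "Jordan_Normal_Form.Matrix"
begin

no_notation Finite_Cartesian_Product.vec_nth (infixl \<open>$\<close> 90)

section \<open>Complex normed spaces and their operators\<close>

class complex_normed_space = real_normed_vector +
  fixes scaleC :: "complex \<Rightarrow> 'a \<Rightarrow> 'a" (infixr \<open>*\<^sub>C\<close> 75)
  assumes scaleC_add_right: "a *\<^sub>C (x + y) = a *\<^sub>C x + a *\<^sub>C y"
    and scaleC_add_left: "(a + b) *\<^sub>C x = a *\<^sub>C x + b *\<^sub>C x"
    and scaleC_scaleC: "a *\<^sub>C b *\<^sub>C x = (a * b) *\<^sub>C x"
    and scaleC_of_real: "complex_of_real r *\<^sub>C x = r *\<^sub>R x"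
    and norm_scaleC: "norm (a *\<^sub>C x) = cmod a * norm x"

global_interpretation complex_space:
  vector_space "scaleC :: complex \<Rightarrow> 'a \<Rightarrow> 'a::complex_normed_space"
proof
  fix x :: 'a
  show "1 *\<^sub>C x = x"
    using scaleC_of_real[of 1 x] by simp
qed (simp_all add: scaleC_add_right scaleC_add_left scaleC_scaleC)

definition operator :: "('a::complex_normed_space \<Rightarrow> 'a) \<Rightarrow> bool" where
  "operator T \<longleftrightarrow> Vector_Spaces.linear scaleC scaleC T \<and> continuous_on UNIV T"

definition rigid :: "('a::complex_normed_space \<Rightarrow> 'a) \<Rightarrow> bool" where
  "rigid T \<longleftrightarrow>
    (\<exists>n :: nat \<Rightarrow> nat. strict_mono n \<and> (\<forall>x. (\<lambda>k. (T ^^ n k) x) \<longlonglongrightarrow> x))"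

definition op_invertible :: "('a::complex_normed_space \<Rightarrow> 'a) \<Rightarrow> bool" where
  "op_invertible T \<longleftrightarrow> (\<exists>S. operator S \<and> S \<circ> T = id \<and> T \<circ> S = id)"

definition op_spectrum :: "('a::complex_normed_space \<Rightarrow> 'a) \<Rightarrow> complex set" where
  "op_spectrum T = {z. \<not> op_invertible (\<lambda>x. T x - z *\<^sub>C x)}"


section \<open>The space of square-summable complex sequences\<close>

text \<open>Coordinates are numbered from 0, so coordinate \<open>i\<close> here is the coordinate
  \<open>i + 1\<close> of a sequence indexed by the positive integers.\<close>

typedef ell2 = "{x :: nat \<Rightarrow> complex. summable (\<lambda>i. (cmod (x i))\<^sup>2)}"
  morphisms coord Abs_ell2
  by (rule exI[of _ "\<lambda>_. 0"]) simp

setup_lifting type_definition_ell2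

lemma summable_coord: "summable (\<lambda>i. (cmod (coord x i))\<^sup>2)"
  using coord[of x] by simp

lemma summable_square_add:
  fixes x y :: "nat \<Rightarrow> complex"
  assumes "summable (\<lambda>i. (cmod (x i))\<^sup>2)" and "summable (\<lambda>i. (cmod (y i))\<^sup>2)"
  shows "summable (\<lambda>i. (cmod (x i + y i))\<^sup>2)"
proof (rule summable_comparison_test')
  show "summable (\<lambda>i. 2 * (cmod (x i))\<^sup>2 + 2 * (cmod (y i))\<^sup>2)"
    using assms by (intro summable_add summable_mult)
  fix i :: nat
  have "(cmod (x i + y i))\<^sup>2 \<le> (cmod (x i) + cmod (y i))\<^sup>2"
    by (simp add: norm_triangle_ineq power_mono)
  also have "\<dots> \<le> 2 * (cmod (x i))\<^sup>2 + 2 * (cmod (y i))\<^sup>2"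
    using sum_squares_bound[of "cmod (x i)" "cmod (y i)"] by (simp add: power2_sum)
  finally show "norm ((cmod (x i + y i))\<^sup>2) \<le> 2 * (cmod (x i))\<^sup>2 + 2 * (cmod (y i))\<^sup>2"
    by simp
qed

lemma summable_square_scale:
  fixes x :: "nat \<Rightarrow> complex"
  assumes "summable (\<lambda>i. (cmod (x i))\<^sup>2)"
  shows "summable (\<lambda>i. (cmod (a * x i))\<^sup>2)"
  using assms by (simp add: norm_mult power_mult_distrib summable_mult)

instantiation ell2 :: ab_group_add
begin

lift_definition zero_ell2 :: ell2 is "\<lambda>_. 0"
  by simp

lift_definition plus_ell2 :: "ell2 \<Rightarrow> ell2 \<Rightarrow> ell2" is "\<lambda>x y i. x i + y i"
  by (rule summable_square_add)

lift_definition uminus_ell2 :: "ell2 \<Rightarrow> ell2" is "\<lambda>x i. - x i"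
  by simp

lift_definition minus_ell2 :: "ell2 \<Rightarrow> ell2 \<Rightarrow> ell2" is "\<lambda>x y i. x i - y i"
  subgoal for x y using summable_square_add[of x "\<lambda>i. - y i"] by simp
  done

instance
  by standard (transfer; simp add: fun_eq_iff)+

end

instantiation ell2 :: complex_normed_space
begin

lift_definition scaleC_ell2 :: "complex \<Rightarrow> ell2 \<Rightarrow> ell2" is "\<lambda>a x i. a * x i"
  by (rule summable_square_scale)

definition scaleR_ell2 :: "real \<Rightarrow> ell2 \<Rightarrow> ell2" where
  "scaleR_ell2 r x = complex_of_real r *\<^sub>C x"

lift_definition norm_ell2 :: "ell2 \<Rightarrow> real" is "\<lambda>x. sqrt (\<Sum>i. (cmod (x i))\<^sup>2)" .

definition dist_ell2 :: "ell2 \<Rightarrow> ell2 \<Rightarrow> real" where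
  "dist_ell2 x y = norm (x - y)"

definition sgn_ell2 :: "ell2 \<Rightarrow> ell2" where
  "sgn_ell2 x = inverse (norm x) *\<^sub>R x"

definition uniformity_ell2 :: "(ell2 \<times> ell2) filter" where
  "uniformity_ell2 = (INF e\<in>{0 <..}. principal {(x, y). dist x y < e})"

definition open_ell2 :: "ell2 set \<Rightarrow> bool" where
  "open_ell2 U \<longleftrightarrow> (\<forall>x\<in>U. eventually (\<lambda>(x', y). x' = x \<longrightarrow> y \<in> U) uniformity)"

instance
proof
  fix x y :: ell2 and a b :: complex and r s :: real
  have norm_limit: "(\<lambda>n. L2_set (\<lambda>i. cmod (coord z i)) {..<n}) \<longlonglongrightarrow> norm z" for z :: ell2
    unfolding L2_set_def norm_ell2.rep_eq
    by (intro tendsto_real_sqrt summable_LIMSEQ summable_coord)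
  show "a *\<^sub>C (x + y) = a *\<^sub>C x + a *\<^sub>C y"
    by transfer (simp add: fun_eq_iff distrib_left)
  show "(a + b) *\<^sub>C x = a *\<^sub>C x + b *\<^sub>C x"
    by transfer (simp add: fun_eq_iff distrib_right)
  show "a *\<^sub>C b *\<^sub>C x = (a * b) *\<^sub>C x"
    by transfer (simp add: fun_eq_iff)
  show "complex_of_real r *\<^sub>C x = r *\<^sub>R x"
    by (simp add: scaleR_ell2_def)
  have C4: "norm (a *\<^sub>C x) = cmod a * norm x" for a and x :: ell2
    by transfer (simp add: norm_mult power_mult_distrib suminf_mult real_sqrt_mult)
  then show "norm (a *\<^sub>C x) = cmod a * norm x" .
  show "r *\<^sub>R (x + y) = r *\<^sub>R x + r *\<^sub>R y"
    unfolding scaleR_ell2_def by transfer (simp add: fun_eq_iff distrib_left)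
  show "(r + s) *\<^sub>R x = r *\<^sub>R x + s *\<^sub>R x"
    unfolding scaleR_ell2_def by transfer (simp add: fun_eq_iff distrib_right)
  show "r *\<^sub>R s *\<^sub>R x = (r * s) *\<^sub>R x"
    unfolding scaleR_ell2_def by transfer (simp add: fun_eq_iff)
  show "1 *\<^sub>R x = x"
    unfolding scaleR_ell2_def by transfer simp
  show "norm (r *\<^sub>R x) = \<bar>r\<bar> * norm x"
    unfolding scaleR_ell2_def C4 by simp
  show "norm x = 0 \<longleftrightarrow> x = 0"
    by transfer (simp add: suminf_eq_zero_iff fun_eq_iff)
  show "norm (x + y) \<le> norm x + norm y"
  proof (rule LIMSEQ_le[OF norm_limit tendsto_add[OF norm_limit norm_limit]])
    have "L2_set (\<lambda>i. cmod (coord (x + y) i)) {..<n}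
        \<le> L2_set (\<lambda>i. cmod (coord x i)) {..<n} + L2_set (\<lambda>i. cmod (coord y i)) {..<n}" for n
    proof -
      have "L2_set (\<lambda>i. cmod (coord (x + y) i)) {..<n}
          \<le> L2_set (\<lambda>i. cmod (coord x i) + cmod (coord y i)) {..<n}"
        by (rule L2_set_mono) (simp_all add: plus_ell2.rep_eq norm_triangle_ineq)
      also have "\<dots> \<le> L2_set (\<lambda>i. cmod (coord x i)) {..<n}
          + L2_set (\<lambda>i. cmod (coord y i)) {..<n}"
        by (rule L2_set_triangle_ineq)
      finally show ?thesis .
    qed
    then show "\<exists>N. \<forall>n\<ge>N. L2_set (\<lambda>i. cmod (coord (x + y) i)) {..<n}
        \<le> L2_set (\<lambda>i. cmod (coord x i)) {..<n} + L2_set (\<lambda>i. cmod (coord y i)) {..<n}"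
      by blast
  qed
qed (rule dist_ell2_def sgn_ell2_def uniformity_ell2_def open_ell2_def)+

end


section \<open>Endomorphisms of finite-dimensional Hermitian spaces\<close>

definition vec_norm :: "complex vec \<Rightarrow> real" where
  "vec_norm v = sqrt (\<Sum>i<dim_vec v. (cmod (v $ i))\<^sup>2)"

definition endomorphism :: "nat \<Rightarrow> (complex vec \<Rightarrow> complex vec) \<Rightarrow> bool" where
  "endomorphism n u \<longleftrightarrow>
    u \<in> carrier_vec n \<rightarrow> carrier_vec n \<and>
    (\<forall>v\<in>carrier_vec n. \<forall>w\<in>carrier_vec n. u (v + w) = u v + u w) \<and>
    (\<forall>a. \<forall>v\<in>carrier_vec n. u (a \<cdot>\<^sub>v v) = a \<cdot>\<^sub>v u v)"

definition endomorphism_norm :: "nat \<Rightarrow> (complex vec \<Rightarrow> complex vec) \<Rightarrow> real" where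
  "endomorphism_norm n u = (SUP v\<in>{v \<in> carrier_vec n. vec_norm v \<le> 1}. vec_norm (u v))"


section \<open>Block diagonal operators\<close>

text \<open>For a sequence \<open>n\<close> of block sizes (also numbered from 0), the \<open>k\<close>-th block of a sequence
  consists of its coordinates in the \<open>k\<close>-th of the consecutive intervals of lengths
  \<open>n 0, n 1, \<dots>\<close>. As these intervals cover all indices when the sizes are positive, a sequence
  is determined by its blocks.\<close>

definition block :: "(nat \<Rightarrow> nat) \<Rightarrow> (nat \<Rightarrow> complex) \<Rightarrow> nat \<Rightarrow> complex vec" where
  "block n y k = Matrix.vec (n k) (\<lambda>i. y ((\<Sum>j<k. n j) + i))"

definition block_diagonal_operator :: "(ell2 \<Rightarrow> ell2) \<Rightarrow> bool" where
  "block_diagonal_operator T \<longleftrightarrow>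
    operator T \<and>
    (\<exists>(n :: nat \<Rightarrow> nat) (u :: nat \<Rightarrow> complex vec \<Rightarrow> complex vec).
      (\<forall>k. n k \<ge> 1) \<and>
      (\<forall>k. endomorphism (n k) (u k)) \<and>
      bdd_above (range (\<lambda>k. endomorphism_norm (n k) (u k))) \<and>
      (\<forall>y k. block n (coord (T y)) k = u k (block n (coord y) k)))"

end

theory Submission
  imports Defs "HOL-Real_Asymp.Real_Asymp"
begin

text \<open>The \<open>k\<close>-th block is a weighted cyclic shift of period \<open>N\<^sub>k\<close> whose weights are
  close to \<open>r\<close> on \<open>k\<close> consecutive coordinates and slightly above 1 on the others, with product 1,
  so that its \<open>N\<^sub>k\<close>-th power is the identity. The \<open>N\<^sub>k\<close> divide one another and grow so fast that
  the \<open>N\<^sub>j\<close>-th powers of all later blocks have norm at most 2. Hence the \<open>N\<^sub>j\<close>-th powers of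
  \<open>T\<close> are bounded by 2 and converge strongly to the identity, which gives rigidity and, by Neumann
  series, invertibility of \<open>T - z\<close> for \<open>\<bar>z\<bar> > 1\<close>; for \<open>\<bar>z\<bar> < r\<close> one uses that the inverse of \<open>T\<close>
  has norm at most \<open>1/r\<close>. If \<open>r \<le> \<bar>z\<bar> \<le> 1\<close>, a formal eigenvector for \<open>z\<close> of the \<open>k\<close>-th
  block has its largest coordinate where the weights change, and truncating it there by a triangular
  profile of width \<open>k\<close> gives approximate eigenvectors.\<close>

section \<open>The Hilbert space of square-summable sequences\<close>

lemma norm_ell2_square: "(norm x)\<^sup>2 = (\<Sum>i. (cmod (coord x i))\<^sup>2)"
  by (simp add: norm_ell2.rep_eq suminf_nonneg summable_coord)

lemma sum_coord_le_norm_square: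
  "finite A \<Longrightarrow> (\<Sum>i\<in>A. (cmod (coord x i))\<^sup>2) \<le> (norm x)\<^sup>2"
  unfolding norm_ell2_square by (intro sum_le_suminf summable_coord) auto

lemma cmod_coord_le_norm: "cmod (coord x i) \<le> norm x"
proof (rule power2_le_imp_le)
  show "(cmod (coord x i))\<^sup>2 \<le> (norm x)\<^sup>2"
    using sum_coord_le_norm_square[of "{i}" x] by (simp only: sum.insert sum.empty finite.intros) simp
qed (rule norm_ge_zero)

lemma norm_ell2_leI:
  assumes "\<And>n. (\<Sum>i<n. (cmod (coord x i))\<^sup>2) \<le> C\<^sup>2" and "0 \<le> C"
  shows "norm x \<le> C"
proof -
  have "(norm x)\<^sup>2 \<le> C\<^sup>2"
    unfolding norm_ell2_square by (intro suminf_le_const summable_coord assms(1))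
  then show ?thesis using assms(2) by (rule power2_le_imp_le)
qed

lemma ell2_eqI: "(\<And>i. coord x i = coord y i) \<Longrightarrow> x = y"
  by (simp add: coord_inject[symmetric] fun_eq_iff)

lemma coord_Abs_ell2:
  "summable (\<lambda>i. (cmod (f i))\<^sup>2) \<Longrightarrow> coord (Abs_ell2 f) i = f i"
  by (simp add: Abs_ell2_inverse)

text \<open>Injectivity of \<open>p\<close> means that no coordinate of \<open>x\<close> is counted
  twice. The bound concerns partial sums of a plain sequence, so it can also prove
  square-summability.\<close>

lemma sum_reindexed_coord_le:
  fixes p :: "nat \<Rightarrow> nat"
  assumes "inj p" and le: "\<And>i. cmod (y i) \<le> C * cmod (coord x (p i))"
  shows "(\<Sum>i<n. (cmod (y i))\<^sup>2) \<le> (C * norm x)\<^sup>2"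
proof -
  have "(\<Sum>i<n. (cmod (y i))\<^sup>2) \<le> (\<Sum>i<n. C\<^sup>2 * (cmod (coord x (p i)))\<^sup>2)"
    by (intro sum_mono) (metis le norm_ge_zero power_mono power_mult_distrib)
  also have "\<dots> = C\<^sup>2 * (\<Sum>i\<in>p ` {..<n}. (cmod (coord x i))\<^sup>2)"
    using assms(1) by (simp add: sum_distrib_left sum.reindex inj_on_subset)
  also have "\<dots> \<le> C\<^sup>2 * (norm x)\<^sup>2"
    by (intro mult_left_mono sum_coord_le_norm_square finite_imageI) auto
  finally show ?thesis by (simp add: power_mult_distrib)
qed

lemma norm_le_of_coord_le:
  fixes p :: "nat \<Rightarrow> nat"
  assumes "inj p" and "\<And>i. cmod (coord y i) \<le> C * cmod (coord x (p i))" and "0 \<le> C"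
  shows "norm y \<le> C * norm x"
  using sum_reindexed_coord_le[OF assms(1,2)] assms(3) by (intro norm_ell2_leI) auto

section \<open>Completeness of \<open>ell2\<close>\<close>

instance ell2 :: banach
proof
  fix X :: "nat \<Rightarrow> ell2"
  assume X: "Cauchy X"
  have "Cauchy (\<lambda>n. coord (X n) i)" for i
  proof (rule metric_CauchyI)
    fix e :: real assume "0 < e"
    then obtain M where M: "\<And>m n. M \<le> m \<Longrightarrow> M \<le> n \<Longrightarrow> norm (X m - X n) < e"
      using X unfolding Cauchy_iff by blast
    have "dist (coord (X m) i) (coord (X n) i) < e" if "M \<le> m" "M \<le> n" for m n
      using M[OF that] cmod_coord_le_norm[of "X m - X n" i]
      by (simp add: dist_norm minus_ell2.rep_eq)
    then show "\<exists>M. \<forall>m\<ge>M. \<forall>n\<ge>M. dist (coord (X m) i) (coord (X n) i) < e"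
      by blast
  qed
  then have "convergent (\<lambda>n. coord (X n) i)" for i
    by (rule Cauchy_convergent)
  then obtain l where l: "\<And>i. (\<lambda>n. coord (X n) i) \<longlonglongrightarrow> l i"
    unfolding convergent_def by metis
  \<comment> \<open>The second index of the Cauchy estimate tends to infinity inside finite sums.
    This yields both the square-summability of \<open>l\<close> and the convergence in norm.\<close>
  have tail: "\<exists>M. \<forall>n\<ge>M. \<forall>m. (\<Sum>i<m. (cmod (coord (X n) i - l i))\<^sup>2) \<le> e\<^sup>2" if e: "0 < e" for e
  proof -
    obtain M where M: "\<And>m n. M \<le> m \<Longrightarrow> M \<le> n \<Longrightarrow> norm (X m - X n) < e"
      using X e unfolding Cauchy_iff by blast
    have "(\<Sum>i<m. (cmod (coord (X n) i - l i))\<^sup>2) \<le> e\<^sup>2" if "M \<le> n" for n m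
    proof (rule LIMSEQ_le_const2)
      show "(\<lambda>j. \<Sum>i<m. (cmod (coord (X n) i - coord (X j) i))\<^sup>2)
          \<longlonglongrightarrow> (\<Sum>i<m. (cmod (coord (X n) i - l i))\<^sup>2)"
        by (intro tendsto_intros l)
      have "(\<Sum>i<m. (cmod (coord (X n) i - coord (X j) i))\<^sup>2) \<le> e\<^sup>2" if "M \<le> j" for j
        using sum_coord_le_norm_square[of "{..<m}" "X n - X j"] M[OF \<open>M \<le> n\<close> that]
          power_mono[of "norm (X n - X j)" e 2]
        by (simp add: minus_ell2.rep_eq)
      then show "\<exists>N. \<forall>j\<ge>N. (\<Sum>i<m. (cmod (coord (X n) i - coord (X j) i))\<^sup>2) \<le> e\<^sup>2"
        by blast
    qed
    then show ?thesis by blast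
  qed
  obtain M where M: "\<And>m. (\<Sum>i<m. (cmod (coord (X M) i - l i))\<^sup>2) \<le> 1\<^sup>2"
    using tail[of 1] by auto
  have "summable (\<lambda>i. (cmod (coord (X M) i - l i))\<^sup>2)"
    by (rule summableI_nonneg_bounded[OF _ M]) simp
  \<comment> \<open>\<open>l\<close> is \<open>X M\<close> minus the square-summable sequence
    \<open>X M - l\<close>.\<close>
  from summable_square_add[OF summable_coord[of "X M"], of "\<lambda>i. - (coord (X M) i - l i)"] this
  have "summable (\<lambda>i. (cmod (l i))\<^sup>2)"
    by (simp add: norm_minus_commute)
  then have coord_l: "coord (Abs_ell2 l) i = l i" for i
    by (rule coord_Abs_ell2)
  have "X \<longlonglongrightarrow> Abs_ell2 l"
  proof (rule LIMSEQ_I)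
    fix e :: real assume "0 < e"
    then obtain M where "\<And>n m. M \<le> n \<Longrightarrow> (\<Sum>i<m. (cmod (coord (X n) i - l i))\<^sup>2) \<le> (e / 2)\<^sup>2"
      using tail[OF half_gt_zero] by blast
    then have "norm (X n - Abs_ell2 l) \<le> e / 2" if "M \<le> n" for n
      using that \<open>0 < e\<close> by (intro norm_ell2_leI) (auto simp: minus_ell2.rep_eq coord_l)
    moreover have "e / 2 < e"
      using \<open>0 < e\<close> by simp
    ultimately show "\<exists>M. \<forall>n\<ge>M. norm (X n - Abs_ell2 l) < e"
      using le_less_trans by blast
  qed
  then show "convergent X" unfolding convergent_def by blast
qed

section \<open>Tails of a square-summable sequence\<close>

lift_definition tail_ell2 :: "nat \<Rightarrow> ell2 \<Rightarrow> ell2" is "\<lambda>n x i. if i < n then 0 else x i"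
  subgoal for n x
    by (rule summable_comparison_test'[of "\<lambda>i. (cmod (x i))\<^sup>2" 0]) auto
  done

lemma tail_ell2_tendsto_zero: "(\<lambda>n. tail_ell2 n x) \<longlonglongrightarrow> 0"
proof -
  have "(norm (tail_ell2 n x))\<^sup>2 = (norm x)\<^sup>2 - (\<Sum>i<n. (cmod (coord x i))\<^sup>2)" for n
    unfolding norm_ell2_square
    using suminf_split_initial_segment[OF summable_coord[of "tail_ell2 n x"], of n]
      suminf_split_initial_segment[OF summable_coord[of x], of n]
    by (simp add: tail_ell2.rep_eq)
  moreover have "(\<lambda>n. (norm x)\<^sup>2 - (\<Sum>i<n. (cmod (coord x i))\<^sup>2)) \<longlonglongrightarrow> 0"
    using tendsto_diff[OF tendsto_const[of "(norm x)\<^sup>2"] summable_LIMSEQ[OF summable_coord[of x]]]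
    by (simp add: norm_ell2_square)
  ultimately have "(\<lambda>n. sqrt ((norm (tail_ell2 n x))\<^sup>2)) \<longlonglongrightarrow> sqrt 0"
    by (intro tendsto_real_sqrt) simp
  then show ?thesis by (simp add: tendsto_norm_zero_iff)
qed

section \<open>Operators and invertibility\<close>

context
  fixes T :: "'a::complex_normed_space \<Rightarrow> 'a"
  assumes T: "operator T"
begin

lemma operator_add: "T (x + y) = T x + T y"
  using T[unfolded operator_def] by (simp add: Vector_Spaces.linear_iff)

lemma operator_scale: "T (a *\<^sub>C x) = a *\<^sub>C T x"
  using T[unfolded operator_def] by (simp add: Vector_Spaces.linear_iff)

lemma operator_diff: "T (x - y) = T x - T y"
  using operator_add[of "x - y" y] by simp

lemma operator_zero: "T 0 = 0"
  using operator_diff[of 0 0] by simp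

lemma operator_minus: "T (- x) = - T x"
  using operator_diff[of 0 x] by (simp add: operator_zero)

lemma operator_continuous: "continuous_on UNIV T"
  using T unfolding operator_def by simp

end

lemma operatorI:
  fixes T :: "'a::complex_normed_space \<Rightarrow> 'a"
  assumes "\<And>x y. T (x + y) = T x + T y" and "\<And>a x. T (a *\<^sub>C x) = a *\<^sub>C T x"
    and "\<And>x. norm (T x) \<le> C * norm x"
  shows "operator T"
proof -
  have "bounded_linear T"
  proof (rule bounded_linear_intro[where K = C])
    show "T (a *\<^sub>R x) = a *\<^sub>R T x" for a x
      unfolding scaleC_of_real[symmetric] by (rule assms(2))
  qed (use assms in \<open>auto simp: mult.commute\<close>)
  then have "continuous_on UNIV T"
    by (rule linear_continuous_on)
  then show ?thesis
    unfolding operator_def using assms(1,2)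
    by (simp add: Vector_Spaces.linear_iff complex_space.vector_space_axioms)
qed

lemma operator_comp: "operator S \<Longrightarrow> operator T \<Longrightarrow> operator (S \<circ> T)"
  unfolding operator_def
  by (metis Vector_Spaces.linear_compose continuous_on_compose continuous_on_subset subset_UNIV)


lemma operator_diff_scale: "operator T \<Longrightarrow> operator (\<lambda>x. T x - z *\<^sub>C x)"
  for T :: "'a::complex_normed_space \<Rightarrow> 'a"
proof -
  assume T: "operator T"
  have "bounded_linear (\<lambda>x::'a. z *\<^sub>C x)"
    by (rule bounded_linear_intro[where K = "cmod z"])
      (simp_all add: scaleC_add_right norm_scaleC scaleC_scaleC mult.commute flip: scaleC_of_real)
  then have "continuous_on UNIV (\<lambda>x::'a. z *\<^sub>C x)"
    by (rule linear_continuous_on)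
  then have "continuous_on UNIV (\<lambda>x. T x - z *\<^sub>C x)"
    by (rule continuous_on_diff[OF operator_continuous[OF T]])
  then show ?thesis
    unfolding operator_def
    by (simp add: Vector_Spaces.linear_iff complex_space.vector_space_axioms operator_add[OF T]
        operator_scale[OF T] scaleC_add_right scaleC_scaleC mult.commute
        complex_space.scale_right_diff_distrib)
qed

text \<open>Solving \<open>A x - z x = y\<close> means finding a fixed point of a contraction of
  ratio \<open>q / cmod z\<close>, which Banach's theorem supplies. The lower bound then gives
  uniqueness and continuity of the inverse.\<close>

lemma op_invertible_Neumann:
  fixes A :: "'a::{complex_normed_space, banach} \<Rightarrow> 'a"
  assumes A: "operator A" and bound: "\<And>x. norm (A x) \<le> q * norm x"
    and q: "0 \<le> q" "q < cmod z"
  shows "op_invertible (\<lambda>x. A x - z *\<^sub>C x)"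
proof -
  define L where "L x = A x - z *\<^sub>C x" for x
  have L: "operator L"
    unfolding L_def by (rule operator_diff_scale[OF A])
  have z: "z \<noteq> 0" using q by auto
  have lower: "(cmod z - q) * norm x \<le> norm (L x)" for x
    using norm_triangle_ineq2[of "z *\<^sub>C x" "A x"] bound[of x]
    by (simp add: L_def norm_minus_commute norm_scaleC left_diff_distrib)
  have "\<exists>x. L x = y" for y
  proof -
    define F where "F x = inverse z *\<^sub>C (A x - y)" for x
    have "\<exists>!x. F x = x"
    proof (rule banach_fix_type)
      show "\<forall>x w. dist (F x) (F w) \<le> (q / cmod z) * dist x w"
      proof (intro allI)
        fix x w
        have "F x - F w = inverse z *\<^sub>C A (x - w)"
          by (simp add: F_def operator_diff[OF A] complex_space.scale_right_diff_distrib)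
        then have "dist (F x) (F w) = norm (A (x - w)) / cmod z"
          by (simp add: dist_norm norm_scaleC norm_inverse divide_inverse mult.commute)
        also have "\<dots> \<le> (q * norm (x - w)) / cmod z"
          by (intro divide_right_mono bound) simp
        finally show "dist (F x) (F w) \<le> (q / cmod z) * dist x w"
          by (simp add: dist_norm)
      qed
    qed (use q in \<open>auto simp: divide_less_eq\<close>)
    then obtain x where "F x = x" by blast
    then have "z *\<^sub>C x = A x - y"
      using z scaleC_scaleC[of z "inverse z" "A x - y"] by (simp add: F_def)
    then show ?thesis
      by (intro exI[of _ x]) (simp add: L_def)
  qed
  then obtain S where S: "\<And>y. L (S y) = y" by metis
  have inj: "x = w" if "L x = L w" for x w
    using lower[of "x - w"] that q by (simp add: operator_diff[OF L] mult_le_0_iff)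
  have "operator S"
  proof (rule operatorI[where C = "inverse (cmod z - q)"])
    show "S (x + y) = S x + S y" for x y
      by (rule inj) (simp add: S operator_add[OF L])
    show "S (a *\<^sub>C x) = a *\<^sub>C S x" for a x
      by (rule inj) (simp add: S operator_scale[OF L])
    show "norm (S x) \<le> inverse (cmod z - q) * norm x" for x
      using lower[of "S x"] q by (simp add: S field_simps)
  qed
  moreover have "S \<circ> L = id" "L \<circ> S = id"
    by (auto simp: fun_eq_iff S intro: inj)
  ultimately show ?thesis
    unfolding op_invertible_def L_def[symmetric] by blast
qed

text \<open>The inverse \<open>S\<close> of \<open>A B\<close> commutes with \<open>B\<close>, so
  \<open>B S\<close> inverts \<open>A\<close> on both sides.\<close>

lemma op_invertible_of_commuting_comp:
  assumes B: "operator B" and comm: "B \<circ> A = A \<circ> B" and inv: "op_invertible (A \<circ> B)"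
  shows "op_invertible A"
proof -
  obtain S where S: "operator S" "S \<circ> (A \<circ> B) = id" "(A \<circ> B) \<circ> S = id"
    using inv unfolding op_invertible_def by blast
  have "S \<circ> B = (S \<circ> B) \<circ> (A \<circ> (B \<circ> S))"
    using S(3) by (simp add: comp_assoc)
  also have "\<dots> = (S \<circ> (B \<circ> A)) \<circ> (B \<circ> S)"
    by (simp add: comp_assoc)
  also have "\<dots> = B \<circ> S"
    using S(2) comm by simp
  finally have "S \<circ> B = B \<circ> S" .
  then have "(B \<circ> S) \<circ> A = id"
    using S(2) comm by (metis comp_assoc)
  moreover have "A \<circ> (B \<circ> S) = id"
    using S(3) by (simp add: comp_assoc)
  ultimately show ?thesis
    unfolding op_invertible_def using operator_comp[OF B S(1)] by blast
qed

text \<open>The witness is the geometric sum of \<open>z ^ (p - 1 - i)\<close> times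
  \<open>T ^^ i\<close> over \<open>i < p\<close>, built by the recursion from \<open>B\<close> to
  \<open>T B + z ^ p\<close>.\<close>

lemma operator_power_diff_factor:
  assumes T: "operator T"
  shows "\<exists>B. operator B \<and> (\<forall>x. T (B x) - z *\<^sub>C B x = (T ^^ p) x - z ^ p *\<^sub>C x)
    \<and> (\<forall>x. B (T x - z *\<^sub>C x) = (T ^^ p) x - z ^ p *\<^sub>C x)"
proof (induction p)
  case 0
  show ?case
    by (rule exI[of _ "\<lambda>_. 0"]) (auto intro!: operatorI[where C = 0] simp: operator_zero[OF T])
next
  case (Suc p)
  then obtain B where B: "operator B"
    "\<And>x. T (B x) - z *\<^sub>C B x = (T ^^ p) x - z ^ p *\<^sub>C x"
    "\<And>x. B (T x - z *\<^sub>C x) = (T ^^ p) x - z ^ p *\<^sub>C x"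
    by blast
  \<comment> \<open>The double negation puts \<open>T B + z ^ p\<close> into the form covered by
    \<open>operator_diff_scale\<close>.\<close>
  define B' where "B' x = T (B x) - (- (z ^ p)) *\<^sub>C x" for x
  have "operator B'"
    unfolding B'_def using operator_diff_scale[OF operator_comp[OF T B(1)], of "- (z ^ p)"]
    by (simp only: comp_def)
  moreover have "B' (T x - z *\<^sub>C x) = (T ^^ Suc p) x - z ^ Suc p *\<^sub>C x" for x
    unfolding B'_def B(3)
    by (simp add: operator_diff[OF T] operator_scale[OF T] complex_space.scale_right_diff_distrib
        scaleC_scaleC mult.commute)
  moreover have "T (B' x) - z *\<^sub>C B' x = (T ^^ Suc p) x - z ^ Suc p *\<^sub>C x" for x
  proof -
    have "T (B' x) - z *\<^sub>C B' x
        = T (T (B x) - z *\<^sub>C B x) + z ^ p *\<^sub>C T x - z ^ Suc p *\<^sub>C x"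
      by (simp add: B'_def operator_add[OF T] operator_diff[OF T] operator_scale[OF T]
          scaleC_add_right scaleC_scaleC)
    also have "\<dots> = (T ^^ Suc p) x - z ^ Suc p *\<^sub>C x"
      unfolding B(2) by (simp add: operator_diff[OF T] operator_scale[OF T])
    finally show ?thesis .
  qed
  ultimately show ?case by blast
qed

text \<open>One bounded power suffices: the Neumann criterion inverts \<open>T ^^ p - z ^ p\<close>,
  of which \<open>T - z\<close> is a factor commuting with its cofactor.\<close>

lemma op_invertible_of_power_bound:
  fixes T :: "'a::{complex_normed_space, banach} \<Rightarrow> 'a"
  assumes T: "operator T" and "\<And>x. norm ((T ^^ p) x) \<le> C * norm x"
    and "0 \<le> C" "C < cmod z ^ p"
  shows "op_invertible (\<lambda>x. T x - z *\<^sub>C x)"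
proof -
  obtain B where B: "operator B"
    "\<And>x. T (B x) - z *\<^sub>C B x = (T ^^ p) x - z ^ p *\<^sub>C x"
    "\<And>x. B (T x - z *\<^sub>C x) = (T ^^ p) x - z ^ p *\<^sub>C x"
    using operator_power_diff_factor[OF T] by blast
  have "operator (T ^^ p)"
  proof (induction p)
    case 0
    show ?case by (rule operatorI[where C = 1]) simp_all
  next
    case (Suc p)
    then show ?case using operator_comp[OF T] by (simp only: funpow.simps)
  qed
  then have inv: "op_invertible (\<lambda>x. (T ^^ p) x - z ^ p *\<^sub>C x)"
    using assms(2-4) by (intro op_invertible_Neumann) (auto simp: norm_power)
  show ?thesis
  proof (rule op_invertible_of_commuting_comp[OF B(1)])
    show "B \<circ> (\<lambda>x. T x - z *\<^sub>C x) = (\<lambda>x. T x - z *\<^sub>C x) \<circ> B"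
      by (simp only: comp_def B(2,3))
    show "op_invertible ((\<lambda>x. T x - z *\<^sub>C x) \<circ> B)"
      unfolding comp_def B(2) by (rule inv)
  qed
qed

text \<open>Composing \<open>T - z\<close> with \<open>- V\<close> gives \<open>z V - 1\<close>, and
  \<open>z V\<close> has norm at most \<open>cmod z * C < 1\<close>.\<close>

lemma op_invertible_near_invertible:
  fixes T :: "'a::{complex_normed_space, banach} \<Rightarrow> 'a"
  assumes T: "operator T" and V: "operator V" "\<And>x. T (V x) = x" "\<And>x. V (T x) = x"
    and bound: "\<And>x. norm (V x) \<le> C * norm x" and "0 \<le> C" "cmod z * C < 1"
  shows "op_invertible (\<lambda>x. T x - z *\<^sub>C x)"
proof -
  have bound': "norm (a *\<^sub>C V x) \<le> (cmod a * C) * norm x" for a x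
    using bound[of x] by (simp add: norm_scaleC mult.assoc mult_left_mono)
  then have opV: "operator (\<lambda>x. a *\<^sub>C V x)" for a
    by (rule operatorI[rotated 2])
      (simp_all add: operator_add[OF V(1)] operator_scale[OF V(1)] scaleC_add_right
        scaleC_scaleC mult.commute)
  have inv: "op_invertible (\<lambda>x. z *\<^sub>C V x - 1 *\<^sub>C x)"
    using assms(6,7) by (intro op_invertible_Neumann[OF opV bound']) auto
  show ?thesis
  proof (rule op_invertible_of_commuting_comp[OF opV[of "-1"]])
    show "(\<lambda>x. - 1 *\<^sub>C V x) \<circ> (\<lambda>x. T x - z *\<^sub>C x) = (\<lambda>x. T x - z *\<^sub>C x) \<circ> (\<lambda>x. - 1 *\<^sub>C V x)"
      by (simp add: fun_eq_iff operator_diff[OF V(1)] operator_scale[OF V(1)] V(2,3)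
          operator_minus[OF T])
    show "op_invertible ((\<lambda>x. T x - z *\<^sub>C x) \<circ> (\<lambda>x. - 1 *\<^sub>C V x))"
      using inv by (simp add: comp_def V(2) operator_minus[OF T])
  qed
qed

text \<open>A continuous inverse would carry the vectors \<open>T (v k) - z (v k)\<close>, which
  tend to 0, back to \<open>v k\<close>, whose norms stay away from 0.\<close>

lemma not_op_invertible_approx_eigenvector:
  fixes T :: "'a::complex_normed_space \<Rightarrow> 'a"
  assumes "(\<lambda>k. T (v k) - z *\<^sub>C v k) \<longlonglongrightarrow> 0" and "\<And>k. 1 \<le> norm (v k)"
  shows "\<not> op_invertible (\<lambda>x. T x - z *\<^sub>C x)"
proof
  assume "op_invertible (\<lambda>x. T x - z *\<^sub>C x)"
  then obtain S where S: "operator S" "S \<circ> (\<lambda>x. T x - z *\<^sub>C x) = id"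
    unfolding op_invertible_def by blast
  have "isCont S 0"
    using operator_continuous[OF S(1)] by (simp add: continuous_on_eq_continuous_at)
  then have "(\<lambda>k. S (T (v k) - z *\<^sub>C v k)) \<longlonglongrightarrow> S 0"
    using assms(1) by (rule isCont_tendsto_compose)
  then have "v \<longlonglongrightarrow> 0"
    using S(2) by (simp add: operator_zero[OF S(1)] fun_eq_iff)
  then have "(\<lambda>k. norm (v k)) \<longlonglongrightarrow> 0"
    by (rule tendsto_norm_zero)
  then have "1 \<le> (0::real)"
    by (rule LIMSEQ_le_const) (use assms(2) in auto)
  then show False by simp
qed

section \<open>Weighted composition operators\<close>

text \<open>\<open>Abs_ell2\<close> is informative only on square-summable sequences;
  \<open>coord_weighted_comp\<close> settles this for injective \<open>p\<close> and bounded
  \<open>a\<close>.\<close>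

definition weighted_comp :: "(nat \<Rightarrow> complex) \<Rightarrow> (nat \<Rightarrow> nat) \<Rightarrow> ell2 \<Rightarrow> ell2" where
  "weighted_comp a p x = Abs_ell2 (\<lambda>i. a i * coord x (p i))"

context
  fixes a :: "nat \<Rightarrow> complex" and p :: "nat \<Rightarrow> nat" and C :: real
  assumes inj: "inj p" and bound: "\<And>i. cmod (a i) \<le> C"
begin

lemma coord_weighted_comp: "coord (weighted_comp a p x) i = a i * coord x (p i)"
proof -
  have "(\<Sum>i<n. (cmod (a i * coord x (p i)))\<^sup>2) \<le> (C * norm x)\<^sup>2" for n
    by (rule sum_reindexed_coord_le[OF inj]) (simp add: norm_mult bound mult_right_mono)
  then have "summable (\<lambda>i. (cmod (a i * coord x (p i)))\<^sup>2)"
    by (intro summableI_nonneg_bounded) auto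
  then show ?thesis
    unfolding weighted_comp_def by (rule coord_Abs_ell2)
qed

lemma norm_weighted_comp_le: "norm (weighted_comp a p x) \<le> C * norm x"
proof (rule norm_le_of_coord_le[OF inj])
  show "0 \<le> C" using bound norm_ge_zero order_trans by blast
qed (simp add: coord_weighted_comp norm_mult bound mult_right_mono)

lemma operator_weighted_comp: "operator (weighted_comp a p)"
  by (rule operatorI[OF _ _ norm_weighted_comp_le])
    (auto intro!: ell2_eqI simp: coord_weighted_comp plus_ell2.rep_eq scaleC_ell2.rep_eq distrib_left)

lemma coord_weighted_comp_power:
  "coord ((weighted_comp a p ^^ j) x) i = (\<Prod>l<j. a ((p ^^ l) i)) * coord x ((p ^^ j) i)"
proof (induction j arbitrary: i)
  case (Suc j)
  have "(\<Prod>l<Suc j. a ((p ^^ l) i)) = a i * (\<Prod>l<j. a ((p ^^ l) (p i)))"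
    by (simp add: prod.lessThan_Suc_shift funpow_swap1 del: prod.lessThan_Suc)
  moreover have "(p ^^ Suc j) i = (p ^^ j) (p i)"
    by (simp add: funpow_swap1)
  ultimately show ?case
    by (simp only: funpow.simps comp_apply coord_weighted_comp Suc.IH mult.assoc)
qed simp

end

section \<open>The blocks and the cyclic shift of each block\<close>

text \<open>The square spreads the expansion of a block so thinly that one preceding period sees a
  factor of at most 2. The factor 2 leaves room for the contracting coordinates and for a profile of
  length \<open>2 * k\<close>.\<close>

primrec period :: "nat \<Rightarrow> nat" where
  "period 0 = 1"
| "period (Suc k) = 2 * (Suc k)\<^sup>2 * period k"

lemma period_pos: "0 < period k"
  by (induction k) auto

lemma Suc_le_square_period: "Suc k \<le> (Suc k)\<^sup>2 * period k"
proof -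
  have "Suc k * 1 \<le> Suc k * (Suc k * period k)"
    using period_pos[of k] by (intro mult_le_mono2) simp
  then show ?thesis by (simp only: power2_eq_square mult.assoc mult_1_right)
qed

lemma period_Suc_ge: "(Suc k)\<^sup>2 * period k + Suc k \<le> period (Suc k)"
  using Suc_le_square_period[of k] by (simp only: period.simps mult.assoc)

lemma two_mult_le_period: "2 * k \<le> period k"
proof (cases k)
  case (Suc l)
  then show ?thesis
    using Suc_le_square_period[of l] by (simp only: period.simps mult.assoc) simp
qed simp

lemma less_period: "k < period k"
  using two_mult_le_period[of k] period_pos[of k] by linarith

lemma period_dvd: "j \<le> k \<Longrightarrow> period j dvd period k"
  by (induction k rule: dec_induct) (auto intro: dvd_trans)

lemma period_mono: "j \<le> k \<Longrightarrow> period j \<le> period k"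
  using period_dvd period_pos dvd_imp_le by blast

section \<open>Positions within blocks and the cyclic shift\<close>

definition offset :: "nat \<Rightarrow> nat" where
  "offset k = (\<Sum>j<k. period j)"

definition block_of :: "nat \<Rightarrow> nat" where
  "block_of i = (LEAST k. i < offset (Suc k))"

definition block_shift :: "nat \<Rightarrow> nat" where
  "block_shift i = offset (block_of i)
    + Suc (i - offset (block_of i)) mod period (block_of i)"

lemma offset_Suc: "offset (Suc k) = offset k + period k"
  by (simp add: offset_def)

lemma offset_mono: "j \<le> k \<Longrightarrow> offset j \<le> offset k"
  unfolding offset_def by (intro sum_mono2) auto

lemma le_offset: "k \<le> offset k"
proof (induction k)
  case (Suc k)
  then show ?case using period_pos[of k] by (simp add: offset_Suc)
qed simp

lemma block_of_offset [simp]: "q < period k \<Longrightarrow> block_of (offset k + q) = k"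
  unfolding block_of_def
proof (rule Least_equality)
  fix j assume q: "q < period k" and "offset k + q < offset (Suc j)"
  then have "\<not> offset (Suc j) \<le> offset k" by simp
  then show "k \<le> j" using offset_mono[of "Suc j" k] by linarith
qed (simp add: offset_Suc)

lemma less_offset_Suc_block_of: "i < offset (Suc (block_of i))"
  unfolding block_of_def
  by (rule LeastI[of _ i]) (use le_offset[of "Suc i"] in simp)

lemma offset_block_of_le: "offset (block_of i) \<le> i"
proof (cases "block_of i")
  case (Suc k)
  then have "\<not> i < offset (Suc k)"
    using not_less_Least[of k "\<lambda>k. i < offset (Suc k)"] unfolding block_of_def by simp
  then show ?thesis using Suc by simp
qed (simp add: offset_def)

lemma block_cases:
  obtains k q where "q < period k" "i = offset k + q"
proof
  show "i - offset (block_of i) < period (block_of i)"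
    using less_offset_Suc_block_of[of i] offset_block_of_le[of i] by (simp add: offset_Suc)
qed (simp add: offset_block_of_le)

lemma block_shift_power:
  "q < period k \<Longrightarrow> (block_shift ^^ j) (offset k + q) = offset k + (q + j) mod period k"
proof (induction j)
  case (Suc j)
  then show ?case
    by (simp add: block_shift_def mod_Suc_eq period_pos)
qed simp

lemma block_shift_offset:
  "q < period k \<Longrightarrow> block_shift (offset k + q) = offset k + Suc q mod period k"
  using block_shift_power[of q k 1] by simp

lemma block_of_block_shift: "block_of (block_shift i) = block_of i"
proof -
  obtain k q where "q < period k" "i = offset k + q" by (rule block_cases)
  then show ?thesis by (simp add: block_shift_offset period_pos)
qed

lemma block_of_block_shift_power: "block_of ((block_shift ^^ j) i) = block_of i"
  by (induction j) (simp_all add: block_of_block_shift)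

text \<open>The size of each block up to \<open>j\<close> divides \<open>period j\<close>, so the
  block is turned a whole number of times.\<close>

lemma block_shift_power_period:
  assumes "block_of i \<le> j"
  shows "(block_shift ^^ period j) i = i"
proof -
  obtain k q where "q < period k" "i = offset k + q" by (rule block_cases)
  moreover from this obtain m where "period j = period k * m"
    using assms period_dvd[of k j] by (auto elim: dvdE)
  ultimately show ?thesis by (simp add: block_shift_power)
qed

text \<open>The shift preserves blocks, and on a block of size \<open>Suc N\<close> its
  \<open>N\<close>-th power undoes it.\<close>

lemma inj_block_shift: "inj block_shift"
proof (rule injI)
  fix i i' assume eq: "block_shift i = block_shift i'"
  then have blk: "block_of i = block_of i'" by (metis block_of_block_shift)
  define N where "N = period (block_of i) - 1"
  have N: "period (block_of i) = Suc N"
    using period_pos[of "block_of i"] by (simp add: N_def)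
  have "i = (block_shift ^^ N) (block_shift i)"
    using block_shift_power_period[of i "block_of i"] by (simp add: N funpow_swap1)
  also have "\<dots> = (block_shift ^^ N) (block_shift i')"
    by (simp add: eq)
  also have "\<dots> = i'"
    using block_shift_power_period[of i' "block_of i"] by (simp add: N funpow_swap1 flip: blk)
  finally show "i = i'" .
qed

lemma surj_block_shift: "surj block_shift"
proof (rule surjI)
  fix i
  show "block_shift ((block_shift ^^ (period (block_of i) - 1)) i) = i"
    using block_shift_power_period[of i "block_of i"] period_pos[of "block_of i"]
    by (metis Suc_pred' comp_apply funpow.simps(2) le_refl)
qed

section \<open>The weights\<close>

text \<open>The maximum with \<open>2\<^sup>-\<^sup>k\<close> only serves to keep the weights nonzero when \<open>r = 0\<close>.\<close>

definition contraction_weight :: "real \<Rightarrow> nat \<Rightarrow> real" where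
  "contraction_weight r k = max r ((1 / 2) ^ k)"

text \<open>Block \<open>k\<close> has \<open>k\<close> contracting and \<open>period k - k\<close>
  expanding coordinates; the root makes the product of all its weights 1.\<close>

definition expansion_weight :: "real \<Rightarrow> nat \<Rightarrow> real" where
  "expansion_weight r k = root (period k - k) (1 / contraction_weight r k ^ k)"

definition weight :: "real \<Rightarrow> nat \<Rightarrow> complex" where
  "weight r i = complex_of_real
    (if i - offset (block_of i) < block_of i then contraction_weight r (block_of i)
     else expansion_weight r (block_of i))"

lemma weight_offset:
  "q < period k \<Longrightarrow> weight r (offset k + q) = complex_of_real
    (if q < k then contraction_weight r k else expansion_weight r k)"
  by (simp add: weight_def)

lemma contraction_weight_pos: "0 < contraction_weight r k"
  by (simp add: contraction_weight_def less_max_iff_disj)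

lemma contraction_weight_ge: "r \<le> contraction_weight r k"
  by (simp add: contraction_weight_def)

section \<open>Bounds for the weights and for their products along orbits\<close>

context
  fixes r :: real
  assumes r_le_1: "r \<le> 1"
begin

lemma contraction_weight_le_1: "contraction_weight r k \<le> 1"
  using r_le_1 by (simp add: contraction_weight_def power_le_one)

lemma expansion_weight_ge_1: "1 \<le> expansion_weight r k"
  unfolding expansion_weight_def
  using contraction_weight_pos[of r k] contraction_weight_le_1[of k] less_period[of k]
  by (simp add: power_le_one)

lemma weight_cycle: "contraction_weight r k ^ k * expansion_weight r k ^ (period k - k) = 1"
  unfolding expansion_weight_def
  using contraction_weight_pos[of r k] less_period[of k]
  by simp

text \<open>All expansions of block \<open>k\<close> together amount to at most
  \<open>2 ^ (k\<^sup>2)\<close>, and there are at least \<open>k\<^sup>2\<close> times the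
  preceding period of them. Extracting a \<open>k\<^sup>2\<close>-th root leaves 2.\<close>

lemma expansion_weight_power_le_2:
  assumes "j < k"
  shows "expansion_weight r k ^ period j \<le> 2"
proof -
  obtain l where l: "k = Suc l" using assms by (cases k) auto
  let ?s = "expansion_weight r k" and ?c = "contraction_weight r k"
  have "(?s ^ period l) ^ (k\<^sup>2) = ?s ^ (k\<^sup>2 * period l)"
    by (simp add: power_mult[symmetric] mult.commute)
  also have "\<dots> \<le> ?s ^ (period k - k)"
    using add_le_imp_le_diff[OF period_Suc_ge[of l]]
    by (intro power_increasing expansion_weight_ge_1) (simp only: l)
  also have "\<dots> = (1 / ?c) ^ k"
    using weight_cycle[of k] contraction_weight_pos[of r k] by (simp add: field_simps)
  \<comment> \<open>The floor \<open>(1 / 2) ^ k\<close> of the contraction weight bounds its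
    inverse.\<close>
  also have "\<dots> \<le> (2 ^ k) ^ k"
  proof (intro power_mono)
    have "(1 / 2) ^ k \<le> ?c" by (simp add: contraction_weight_def)
    then have "1 \<le> ?c * 2 ^ k" by (simp add: field_simps)
    then show "1 / ?c \<le> 2 ^ k"
      using contraction_weight_pos[of r k] by (simp add: field_simps)
  qed (use contraction_weight_pos[of r k] in \<open>simp add: less_imp_le\<close>)
  also have "\<dots> = 2 ^ (k\<^sup>2)"
    by (simp add: power_mult[symmetric] power2_eq_square)
  finally have "(?s ^ period l) ^ (k\<^sup>2) \<le> 2 ^ (k\<^sup>2)" .
  moreover have "0 \<le> ?s ^ period l" "0 < k\<^sup>2"
    using expansion_weight_ge_1[of k] l by simp_all
  ultimately have "?s ^ period l \<le> 2"
    using power_mono_iff[OF _ zero_le_numeral] by blast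
  moreover have "?s ^ period j \<le> ?s ^ period l"
    using assms l by (intro power_increasing period_mono expansion_weight_ge_1) auto
  ultimately show ?thesis by linarith
qed

lemma expansion_weight_le_2: "expansion_weight r k \<le> 2"
proof (cases "k = 0")
  case True
  then show ?thesis by (simp add: expansion_weight_def)
next
  case False
  then show ?thesis using expansion_weight_power_le_2[of 0 k] by simp
qed

lemma cmod_weight_le_expansion: "cmod (weight r i) \<le> expansion_weight r (block_of i)"
  using contraction_weight_pos[of r "block_of i"] contraction_weight_le_1[of "block_of i"]
    expansion_weight_ge_1[of "block_of i"]
  by (simp add: weight_def del: of_real_power)

lemma cmod_weight_le_2: "cmod (weight r i) \<le> 2"
  using cmod_weight_le_expansion[of i] expansion_weight_le_2[of "block_of i"] by linarith

lemma contraction_le_cmod_weight: "contraction_weight r (block_of i) \<le> cmod (weight r i)"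
  using contraction_weight_pos[of r "block_of i"] contraction_weight_le_1[of "block_of i"]
    expansion_weight_ge_1[of "block_of i"]
  by (simp add: weight_def)

lemma weight_nonzero: "weight r i \<noteq> 0"
  using contraction_le_cmod_weight[of i] contraction_weight_pos[of r "block_of i"] by auto

text \<open>The product over a full turn does not depend on the starting point, and from the start
  of the block it is \<open>weight_cycle\<close>.\<close>

lemma prod_weight_one_cycle:
  assumes q: "q < period k"
  shows "(\<Prod>l<period k. weight r ((block_shift ^^ l) (offset k + q))) = 1"
proof -
  let ?N = "period k"
  define f where "f l = weight r (offset k + l mod ?N)" for l
  have "(\<Prod>l<?N. f (m + l)) = 1" for m
  proof (induction m)
    case 0
    have "(\<Prod>l<?N. f l) = (\<Prod>l<?N. complex_of_real
        (if l < k then contraction_weight r k else expansion_weight r k))"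
      by (intro prod.cong) (simp_all add: f_def weight_offset)
    also have "\<dots> = complex_of_real (\<Prod>l<?N. if l < k then contraction_weight r k
        else expansion_weight r k)"
      by simp
    also have "(\<Prod>l<?N. if l < k then contraction_weight r k else expansion_weight r k)
        = contraction_weight r k ^ card {..<k} * expansion_weight r k ^ card {k..<?N}"
    proof -
      have "{..<?N} \<inter> {l. l < k} = {..<k}" "{..<?N} \<inter> - {l. l < k} = {k..<?N}"
        using less_period[of k] by auto
      then show ?thesis by (simp add: prod.If_cases)
    qed
    also have "\<dots> = 1" using weight_cycle by simp
    finally show ?case by simp
  next
    case (Suc m)
    \<comment> \<open>A product of \<open>period k + 1\<close> consecutive factors is split at
      either end; the end factors agree by periodicity and cancel.\<close>
    have "f m * (\<Prod>l<?N. f (Suc m + l)) = (\<Prod>l<Suc ?N. f (m + l))"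
      by (simp add: prod.lessThan_Suc_shift del: prod.lessThan_Suc)
    also have "\<dots> = f m * (\<Prod>l<?N. f (m + l))"
      by (simp add: f_def)
    finally show ?case
      using Suc weight_nonzero by (simp add: f_def)
  qed
  from this[of q] show ?thesis
    by (simp add: f_def block_shift_power[OF q])
qed

lemma prod_weight_period:
  assumes "block_of i \<le> j"
  shows "(\<Prod>l<period j. weight r ((block_shift ^^ l) i)) = 1"
proof -
  obtain k q where i: "q < period k" "i = offset k + q" by (rule block_cases)
  then obtain m where m: "period j = period k * m"
    using assms period_dvd[of k j] by (auto elim: dvdE)
  have shift: "(block_shift ^^ (period k * m + l)) i = (block_shift ^^ l) i" for m l
    using block_shift_power[OF i(1), of "period k * m"] i
    by (subst add.commute) (simp add: funpow_add)
  have "(\<Prod>l<period k * m. weight r ((block_shift ^^ l) i)) = 1" for m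
  proof (induction m)
    case (Suc m)
    have "(\<Prod>l<period k * m + n. weight r ((block_shift ^^ l) i))
        = (\<Prod>l<n. weight r ((block_shift ^^ l) i))" for n
      by (induction n) (simp_all add: Suc shift)
    then show ?case
      using prod_weight_one_cycle[OF i(1)] by (simp add: i(2) add.commute)
  qed simp
  then show ?thesis by (simp add: m)
qed

text \<open>Blocks up to \<open>j\<close> make whole turns with product 1; in later blocks every
  factor is at most the expansion weight.\<close>

lemma cmod_prod_weight_period_le_2: "cmod (\<Prod>l<period j. weight r ((block_shift ^^ l) i)) \<le> 2"
proof (cases "block_of i \<le> j")
  case True
  then show ?thesis by (simp add: prod_weight_period)
next
  case False
  have "cmod (\<Prod>l<period j. weight r ((block_shift ^^ l) i))
      = (\<Prod>l<period j. cmod (weight r ((block_shift ^^ l) i)))"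
    by (simp add: prod_norm)
  also have "\<dots> \<le> (\<Prod>l<period j. expansion_weight r (block_of i))"
    by (intro prod_mono) (metis norm_ge_zero cmod_weight_le_expansion block_of_block_shift_power)
  also have "\<dots> \<le> 2"
    using False expansion_weight_power_le_2[of j "block_of i"] by simp
  finally show ?thesis .
qed

end

section \<open>The operator\<close>

definition block_operator :: "real \<Rightarrow> ell2 \<Rightarrow> ell2" where
  "block_operator r = weighted_comp (weight r) block_shift"

lemma norm_le_of_finite_support:
  assumes "finite S" and "\<And>i. i \<notin> S \<Longrightarrow> coord y i = 0"
    and le: "\<And>i. i \<in> S \<Longrightarrow> cmod (coord y i) \<le> e" and "0 \<le> e"
  shows "norm y \<le> sqrt (card S) * e"
proof (rule norm_ell2_leI)
  fix n
  have "(\<Sum>i<n. (cmod (coord y i))\<^sup>2) \<le> (\<Sum>i<n. if i \<in> S then e\<^sup>2 else 0)"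
    using assms by (intro sum_mono) (auto intro: power_mono)
  also have "\<dots> = (\<Sum>i\<in>{..<n} \<inter> S. e\<^sup>2)"
    by (rule sum.inter_restrict[symmetric]) simp
  also have "\<dots> \<le> (\<Sum>i\<in>S. e\<^sup>2)"
    using \<open>finite S\<close> by (intro sum_mono2) auto
  finally show "(\<Sum>i<n. (cmod (coord y i))\<^sup>2) \<le> (sqrt (card S) * e)\<^sup>2"
    by (simp add: power_mult_distrib)
qed (use \<open>0 \<le> e\<close> in simp)

section \<open>Powers, rigidity, block form and spectrum\<close>

context
  fixes r :: real
  assumes r_le_1: "r \<le> 1"
begin

lemma coord_block_operator:
  "coord (block_operator r x) i = weight r i * coord x (block_shift i)"
  unfolding block_operator_def
  by (rule coord_weighted_comp[OF inj_block_shift cmod_weight_le_2[OF r_le_1]])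

lemma operator_block_operator: "operator (block_operator r)"
  unfolding block_operator_def
  by (rule operator_weighted_comp[OF inj_block_shift cmod_weight_le_2[OF r_le_1]])

lemma coord_block_operator_power:
  "coord ((block_operator r ^^ j) x) i
    = (\<Prod>l<j. weight r ((block_shift ^^ l) i)) * coord x ((block_shift ^^ j) i)"
  unfolding block_operator_def
  by (rule coord_weighted_comp_power[OF inj_block_shift cmod_weight_le_2[OF r_le_1]])

lemma norm_block_operator_power_le:
  "norm ((block_operator r ^^ period j) x) \<le> 2 * norm x"
  by (rule norm_le_of_coord_le[OF inj_fn[OF inj_block_shift, of "period j"]])
    (auto simp: coord_block_operator_power norm_mult
      intro!: mult_right_mono cmod_prod_weight_period_le_2[OF r_le_1])

text \<open>The power \<open>period j\<close> fixes all coordinates in blocks up to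
  \<open>j\<close>. Only the tail remains, contributing at most twice its norm plus its norm, whence
  the factor 3.\<close>

lemma rigid_block_operator: "rigid (block_operator r)"
  unfolding rigid_def
proof (intro exI[of _ period] conjI allI)
  show "strict_mono period"
    unfolding strict_mono_Suc_iff
  proof
    fix k
    have "1 * period k \<le> (Suc k)\<^sup>2 * period k"
      by (rule mult_le_mono1) simp
    then show "period k < period (Suc k)"
      using period_Suc_ge[of k] by linarith
  qed
  fix x :: ell2
  have "(\<lambda>j. tail_ell2 (offset (Suc j)) x) \<longlonglongrightarrow> 0"
  proof (rule filterlim_compose[OF tail_ell2_tendsto_zero])
    show "filterlim (\<lambda>j. offset (Suc j)) sequentially sequentially"
      by (rule filterlim_at_top_mono[OF filterlim_Suc]) (simp add: le_offset)
  qed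
  then have lim: "(\<lambda>j. 3 * norm (tail_ell2 (offset (Suc j)) x)) \<longlonglongrightarrow> 0"
    by (intro tendsto_mult_right_zero tendsto_norm_zero)
  have "norm ((block_operator r ^^ period j) x - x)
      \<le> 3 * norm (tail_ell2 (offset (Suc j)) x)" for j
  proof -
    let ?y = "tail_ell2 (offset (Suc j)) x"
    have "(block_operator r ^^ period j) x - x = (block_operator r ^^ period j) ?y - ?y"
    proof (rule ell2_eqI)
      fix i
      show "coord ((block_operator r ^^ period j) x - x) i
          = coord ((block_operator r ^^ period j) ?y - ?y) i"
      proof (cases "block_of i \<le> j")
        case True
        then show ?thesis
          by (simp add: minus_ell2.rep_eq coord_block_operator_power block_shift_power_period
              prod_weight_period[OF r_le_1])
      next
        case False
        \<comment> \<open>The shift stays inside a later block, where \<open>x\<close> and its tail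
          agree.\<close>
        then have "offset (Suc j) \<le> m" if "block_of m = block_of i" for m
          using that offset_mono[of "Suc j" "block_of m"] offset_block_of_le[of m] by simp
        then have "\<not> i < offset (Suc j)" "\<not> (block_shift ^^ period j) i < offset (Suc j)"
          by (simp_all add: block_of_block_shift_power not_less)
        then show ?thesis
          by (simp add: minus_ell2.rep_eq coord_block_operator_power tail_ell2.rep_eq)
      qed
    qed
    also have "norm \<dots> \<le> norm ((block_operator r ^^ period j) ?y) + norm ?y"
      by (rule norm_triangle_ineq4)
    finally show ?thesis
      using norm_block_operator_power_le[of j ?y] by linarith
  qed
  then have "(\<lambda>j. (block_operator r ^^ period j) x - x) \<longlonglongrightarrow> 0"
    by (intro Lim_null_comparison[OF _ lim] always_eventually allI)
  then show "(\<lambda>j. (block_operator r ^^ period j) x) \<longlonglongrightarrow> x"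
    by (rule LIM_zero_cancel)
qed

lemma block_diagonal_block_operator: "block_diagonal_operator (block_operator r)"
  unfolding block_diagonal_operator_def
proof (intro conjI operator_block_operator exI allI)
  define u where "u k v = Matrix.vec (period k)
    (\<lambda>q. weight r (offset k + q) * v $ (Suc q mod period k))" for k and v :: "complex vec"
  have mod_less: "m mod period k < period k" for m k
    by (simp add: period_pos)
  show "1 \<le> period k" for k
    using period_pos[of k] by simp
  show "endomorphism (period k) (u k)" for k
    unfolding endomorphism_def
    by (auto simp: u_def mod_less distrib_left)
  \<comment> \<open>The cyclic successor permutes the coordinates of a block, so the norm of
    \<open>u k\<close> is controlled by the weights alone.\<close>
  have bij: "bij_betw (\<lambda>q. Suc q mod period k) {..<period k} {..<period k}" for k
  proof (rule bij_betwI')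
    fix q q' assume "q \<in> {..<period k}" "q' \<in> {..<period k}"
    then show "(Suc q mod period k = Suc q' mod period k) = (q = q')"
      by (auto simp: mod_Suc split: if_splits)
  next
    fix q assume q: "q \<in> {..<period k}"
    show "\<exists>q'\<in>{..<period k}. q = Suc q' mod period k"
    proof (cases q)
      case 0
      then show ?thesis
        using period_pos[of k] by (intro bexI[of _ "period k - 1"]) auto
    qed (use q in \<open>auto intro: bexI[of _ "q - 1"]\<close>)
  qed (simp add: mod_less)
  have "vec_norm (u k v) \<le> 2" if v: "v \<in> carrier_vec (period k)" "vec_norm v \<le> 1" for k v
  proof -
    have "(\<Sum>q<period k. (cmod (u k v $ q))\<^sup>2)
        \<le> (\<Sum>q<period k. 2\<^sup>2 * (cmod (v $ (Suc q mod period k)))\<^sup>2)"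
      unfolding u_def
      by (intro sum_mono)
        (auto simp: norm_mult power_mult_distrib intro!: mult_right_mono
          power_mono[of _ 2 2, simplified] cmod_weight_le_2[OF r_le_1])
    also have "\<dots> = 2\<^sup>2 * (\<Sum>q<period k. (cmod (v $ q))\<^sup>2)"
      unfolding sum_distrib_left[symmetric]
      by (subst sum.reindex_bij_betw[OF bij, of "\<lambda>q. (cmod (v $ q))\<^sup>2"]) simp
    finally have "(vec_norm (u k v))\<^sup>2 \<le> (2 * vec_norm v)\<^sup>2"
      using v(1) by (simp add: vec_norm_def u_def power_mult_distrib sum_nonneg)
    then have "vec_norm (u k v) \<le> 2 * vec_norm v"
      by (rule power2_le_imp_le) (simp add: vec_norm_def sum_nonneg)
    then show ?thesis using v(2) by linarith
  qed
  \<comment> \<open>\<open>cSUP_least\<close> needs a nonempty set: the zero vector lies in the unit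
    ball.\<close>
  moreover have "0\<^sub>v n \<in> carrier_vec n" "vec_norm (0\<^sub>v n) \<le> 1" for n
    by (simp_all add: vec_norm_def)
  ultimately have "endomorphism_norm (period k) (u k) \<le> 2" for k
    unfolding endomorphism_norm_def by (intro cSUP_least) blast+
  then show "bdd_above (range (\<lambda>k. endomorphism_norm (period k) (u k)))"
    by (intro bdd_aboveI2[where M = 2])
  show "block period (coord (block_operator r y)) k = u k (block period (coord y) k)" for y k
    by (rule eq_vecI)
      (auto simp: block_def u_def mod_less coord_block_operator block_shift_offset
        simp flip: offset_def)
qed

text \<open>All weights have modulus at least \<open>r\<close>, and \<open>r > 0\<close> here, so
  the inverse \<open>V\<close> has norm at most \<open>1 / r\<close>.\<close>

lemma op_invertible_inside:
  assumes "cmod z < r"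
  shows "op_invertible (\<lambda>x. block_operator r x - z *\<^sub>C x)"
proof -
  have r: "0 < r" using assms norm_ge_zero le_less_trans by blast
  \<comment> \<open>Inverting the weighted shift at \<open>i\<close> divides by the weight at the
    preimage of \<open>i\<close>.\<close>
  define b where "b i = 1 / weight r (inv_into UNIV block_shift i)" for i
  define V where "V = weighted_comp b (inv_into UNIV block_shift)"
  have inj: "inj (inv_into UNIV block_shift)"
    by (rule surj_imp_inj_inv[OF surj_block_shift])
  have b: "cmod (b i) \<le> 1 / r" for i
    using contraction_le_cmod_weight[OF r_le_1, of "inv_into UNIV block_shift i"]
      contraction_weight_ge[of r "block_of (inv_into UNIV block_shift i)"] r
    by (simp add: b_def norm_divide frac_le)
  show ?thesis
  proof (rule op_invertible_near_invertible[OF operator_block_operator, of V])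
    show "operator V"
      unfolding V_def by (rule operator_weighted_comp[OF inj b])
    show "block_operator r (V x) = x" for x
      by (rule ell2_eqI)
        (simp add: coord_block_operator V_def coord_weighted_comp[OF inj b] b_def
          inv_f_f[OF inj_block_shift] weight_nonzero[OF r_le_1])
    show "V (block_operator r x) = x" for x
      by (rule ell2_eqI)
        (simp add: coord_block_operator V_def coord_weighted_comp[OF inj b] b_def
          surj_f_inv_f[OF surj_block_shift] weight_nonzero[OF r_le_1])
    show "norm (V x) \<le> 1 / r * norm x" for x
      unfolding V_def by (rule norm_weighted_comp_le[OF inj b])
  qed (use assms r in auto)
qed

text \<open>The powers \<open>period j\<close> are bounded by 2 uniformly in \<open>j\<close>, while
  \<open>cmod z ^ period j\<close> is unbounded.\<close>

lemma op_invertible_outside: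
  assumes "1 < cmod z"
  shows "op_invertible (\<lambda>x. block_operator r x - z *\<^sub>C x)"
proof -
  obtain j where "2 < cmod z ^ j"
    using real_arch_pow[OF assms] by blast
  also have "\<dots> \<le> cmod z ^ period j"
    using assms less_period[of j] by (intro power_increasing) auto
  finally show ?thesis
    by (intro op_invertible_of_power_bound[OF operator_block_operator norm_block_operator_power_le])
      auto
qed

text \<open>The two bounds on \<open>w\<close> keep \<open>c\<close> at most 1 before and after its
  peak. The \<open>2 * k\<close> support coordinates each carry an error of at most
  \<open>1 / k\<close>, and the peak coordinate is 1. The upper bound on \<open>norm v\<close>
  serves to replace \<open>w\<close> by a nearby number later.\<close>

lemma block_operator_approx_eigenvector:
  assumes k: "0 < k" and w: "contraction_weight r k \<le> cmod w" "cmod w \<le> 1"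
  obtains v where "1 \<le> norm v" "norm v \<le> sqrt (2 * k)"
    "norm (block_operator r v - w *\<^sub>C v) \<le> sqrt (2 * k) / k"
proof -
  define c where "c q = (if q \<le> k then (contraction_weight r k / w) ^ (k - q)
    else (w / expansion_weight r k) ^ (q - k))" for q
  define t where "t q = max 0 (1 - \<bar>real q - real k\<bar> / real k)" for q
  \<comment> \<open>\<open>c\<close> solves the eigenvalue equation away from the wrap-around and peaks at \<open>q = k\<close>; the slope of
    \<open>t\<close> is at most \<open>1 / k\<close>, so only terms of that size survive in \<open>T v - w v\<close>.\<close>
  define f where "f q = complex_of_real (t q) * c q" for q
  define S where "S = {offset k..<offset k + 2 * k}"
  define v where "v = Abs_ell2 (\<lambda>i. if i \<in> S then f (i - offset k) else 0)"
  have w0: "w \<noteq> 0" using w(1) contraction_weight_pos[of r k] by auto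
  have coord_v: "coord v i = (if i \<in> S then f (i - offset k) else 0)" for i
    unfolding v_def by (rule coord_Abs_ell2, rule summable_finite[of S]) (auto simp: S_def)
  have c_le: "cmod (c q) \<le> 1" for q
    using w w0 contraction_weight_pos[of r k] expansion_weight_ge_1[OF r_le_1, of k]
    by (auto simp: c_def norm_power norm_divide intro!: power_le_one)
  have c_Suc: "complex_of_real (if q < k then contraction_weight r k else expansion_weight r k)
      * c (Suc q) = w * c q" for q
  proof -
    have "k - q = Suc (k - Suc q)" if "q < k"
      using that by simp
    moreover have "Suc q - k = Suc (q - k)" if "\<not> q < k"
      using that by simp
    moreover have "expansion_weight r k \<noteq> 0"
      using expansion_weight_ge_1[OF r_le_1, of k] by linarith
    ultimately show ?thesis
      using w0 by (auto simp: c_def)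
  qed
  have t_0: "t 0 = 0" and t_k: "t k = 1"
    using k by (simp_all add: t_def)
  have t_ge: "t q = 0" if "2 * k \<le> q" for q
    using k that by (auto simp: t_def field_simps)
  have t_le: "0 \<le> t q" "t q \<le> 1" for q
    by (auto simp: t_def)
  have t_Suc: "\<bar>t (Suc q) - t q\<bar> \<le> 1 / k" for q
  proof -
    \<comment> \<open>The function \<open>max 0 (1 - x)\<close> is 1-Lipschitz.\<close>
    have max: "\<bar>max 0 (1 - b) - max 0 (1 - a)\<bar> \<le> e" if "a \<le> b + e" "b \<le> a + e" for a b e :: real
      using that by (auto simp: max_def)
    have "\<bar>real q - real k\<bar> / k \<le> (\<bar>real (Suc q) - real k\<bar> + 1) / k"
      "\<bar>real (Suc q) - real k\<bar> / k \<le> (\<bar>real q - real k\<bar> + 1) / k"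
      by (intro divide_right_mono; simp)+
    then show ?thesis
      unfolding t_def add_divide_distrib by (rule max)
  qed
  have S_le: "2 * k \<le> period k" by (rule two_mult_le_period)
  have coord_v_offset: "coord v (offset k + q) = f q" for q
    by (auto simp: coord_v S_def f_def t_ge)
  have diff: "coord (block_operator r v - w *\<^sub>C v) (offset k + q)
      = complex_of_real (t (Suc q) - t q) * (w * c q)" if q: "q < period k" for q
  proof -
    \<comment> \<open>At the wrap-around both sides vanish: \<open>t 0 = 0\<close>, and
      \<open>t\<close> is 0 from \<open>2 * k \<le> period k\<close> on.\<close>
    have "f (Suc q mod period k) = f (Suc q)"
      using q S_le t_0 t_ge[of "Suc q"] by (auto simp: f_def mod_Suc)
    then have "coord (block_operator r v - w *\<^sub>C v) (offset k + q)
        = complex_of_real (if q < k then contraction_weight r k else expansion_weight r k)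
          * f (Suc q) - w * f q"
      by (simp only: minus_ell2.rep_eq scaleC_ell2.rep_eq coord_block_operator coord_v_offset
          block_shift_offset[OF q] weight_offset[OF q])
    also have "\<dots> = complex_of_real (t (Suc q)) * (w * c q) - w * f q"
      unfolding c_Suc[symmetric] by (simp add: f_def)
    finally show ?thesis
      by (simp add: f_def algebra_simps)
  qed
  have "norm v \<le> sqrt (card S) * 1"
    using c_le t_le
    by (intro norm_le_of_finite_support)
      (auto simp: coord_v f_def norm_mult S_def intro!: mult_le_one)
  moreover have "norm (block_operator r v - w *\<^sub>C v) \<le> sqrt (card S) * (1 / k)"
  proof (rule norm_le_of_finite_support)
    show "finite S" by (simp add: S_def)
    fix i
    obtain l q where l: "q < period l" "i = offset l + q" by (rule block_cases)
    {
      assume i: "i \<notin> S"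
      show "coord (block_operator r v - w *\<^sub>C v) i = 0"
      proof (cases "l = k")
        case True
        then have "2 * k \<le> q" using i l by (simp add: S_def)
        then show ?thesis using diff[of q] l True t_ge[of q] t_ge[of "Suc q"] by simp
      next
        case False
        \<comment> \<open>Outside block \<open>k\<close> the vector vanishes at \<open>i\<close>
          and, as the shift preserves blocks, at \<open>block_shift i\<close>.\<close>
        have "m \<notin> S" if "block_of m = l" for m
        proof
          assume "m \<in> S"
          then have "block_of (offset k + (m - offset k)) = k"
            using S_le by (intro block_of_offset) (auto simp: S_def)
          then show False using \<open>m \<in> S\<close> that False by (simp add: S_def)
        qed
        then show ?thesis
          using l by (simp add: minus_ell2.rep_eq scaleC_ell2.rep_eq coord_block_operator coord_v
              block_of_block_shift)
      qed
    }
    {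
      assume i: "i \<in> S"
      define m where "m = i - offset k"
      have m: "i = offset k + m" "m < period k"
        using i S_le by (auto simp: m_def S_def)
      have "cmod (complex_of_real (t (Suc m) - t m) * (w * c m)) \<le> (1 / k) * 1"
        unfolding norm_mult
        using t_Suc[of m] w(2) c_le[of m] by (intro mult_mono mult_le_one) (auto simp flip: of_real_diff)
      then show "cmod (coord (block_operator r v - w *\<^sub>C v) i) \<le> 1 / k"
        by (simp only: m(1) diff[OF m(2)] mult_1_right)
    }
  qed simp
  moreover have "1 \<le> norm v"
    using cmod_coord_le_norm[of v "offset k + k"]
    by (simp only: coord_v_offset) (simp add: f_def t_k c_def)
  ultimately show thesis
    by (intro that[of v]) (simp_all add: S_def)
qed

lemma not_op_invertible_annulus:
  assumes z: "r \<le> cmod z" "cmod z \<le> 1"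
  shows "\<not> op_invertible (\<lambda>x. block_operator r x - z *\<^sub>C x)"
proof -
  \<comment> \<open>For \<open>z = 0\<close> the eigenvalue equation of a block cannot be solved, hence the perturbation.\<close>
  define w where "w k = (if (1 / 2) ^ k \<le> cmod z then z else complex_of_real ((1 / 2) ^ k))" for k
  \<comment> \<open>If \<open>w k\<close> is not \<open>z\<close>, then
    \<open>r \<le> cmod z < (1 / 2) ^ k\<close>, so \<open>w k\<close> equals the contraction
    weight.\<close>
  have w: "contraction_weight r k \<le> cmod (w k)" "cmod (w k) \<le> 1" for k
    using z by (auto simp: w_def contraction_weight_def norm_power power_le_one)
  have dist_w: "cmod (w k - z) \<le> 2 * (1 / 2) ^ k" for k
    using norm_triangle_ineq4[of "w k" z] by (auto simp: w_def norm_power)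
  \<comment> \<open>The index is \<open>Suc k\<close> because the construction needs a positive
    block number.\<close>
  have "\<exists>v. 1 \<le> norm v \<and> norm v \<le> sqrt (2 * Suc k) \<and>
      norm (block_operator r v - w (Suc k) *\<^sub>C v) \<le> sqrt (2 * Suc k) / Suc k" for k
    by (rule block_operator_approx_eigenvector[of "Suc k" "w (Suc k)"]) (use w in auto)
  then obtain v where v: "\<And>k. 1 \<le> norm (v k)" "\<And>k. norm (v k) \<le> sqrt (2 * Suc k)"
    "\<And>k. norm (block_operator r (v k) - w (Suc k) *\<^sub>C v k) \<le> sqrt (2 * Suc k) / Suc k"
    by metis
  show ?thesis
  proof (rule not_op_invertible_approx_eigenvector[OF _ v(1)])
    \<comment> \<open>Replacing \<open>w\<close> by \<open>z\<close> costs an exponentially small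
      factor times \<open>norm (v k)\<close>, which grows only like a square root.\<close>
    have bound: "norm (block_operator r (v k) - z *\<^sub>C v k)
        \<le> sqrt (2 * Suc k) / Suc k + 2 * (1 / 2) ^ Suc k * sqrt (2 * Suc k)" for k
    proof -
      have "block_operator r (v k) - z *\<^sub>C v k
          = (block_operator r (v k) - w (Suc k) *\<^sub>C v k) + (w (Suc k) - z) *\<^sub>C v k"
        by (simp add: complex_space.scale_left_diff_distrib)
      also have "norm \<dots> \<le> norm (block_operator r (v k) - w (Suc k) *\<^sub>C v k)
          + cmod (w (Suc k) - z) * norm (v k)"
        using norm_triangle_ineq by (metis norm_scaleC)
      also have "\<dots> \<le> sqrt (2 * Suc k) / Suc k + 2 * (1 / 2) ^ Suc k * sqrt (2 * Suc k)"
        by (intro add_mono v(3) mult_mono dist_w v(2)) auto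
      finally show ?thesis .
    qed
    have "(\<lambda>k. sqrt (2 * Suc k) / Suc k + 2 * (1 / 2) ^ Suc k * sqrt (2 * Suc k)) \<longlonglongrightarrow> 0"
      by real_asymp
    then show "(\<lambda>k. block_operator r (v k) - z *\<^sub>C v k) \<longlonglongrightarrow> 0"
      by (rule Lim_null_comparison[OF always_eventually[OF allI[OF bound]]])
  qed
qed

end

theorem mainTheorem1:
  fixes r :: real
  assumes "r \<in> {0..1}"
  shows "\<exists>T :: ell2 \<Rightarrow> ell2. block_diagonal_operator T \<and> rigid T \<and>
    op_spectrum T = {z. r \<le> cmod z \<and> cmod z \<le> 1}"
proof (intro exI conjI)
  have r: "r \<le> 1" using assms by simp
  show "block_diagonal_operator (block_operator r)"
    by (rule block_diagonal_block_operator[OF r])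
  show "rigid (block_operator r)"
    by (rule rigid_block_operator[OF r])
  show "op_spectrum (block_operator r) = {z. r \<le> cmod z \<and> cmod z \<le> 1}"
    unfolding op_spectrum_def
    using op_invertible_inside[OF r] op_invertible_outside[OF r] not_op_invertible_annulus[OF r]
    by (auto simp: not_less[symmetric])
qed

end
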